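(* In the one-dimensional setting of the context, assume that $\mathtt F_p$ is one-dimensionally admissible for every $p\in(1,2)$ (with $\ell,\xi_1,\xi_2$ independent of $p$), that there is $\mathtt F_1\in C^{0,\theta}_{\mathrm{loc}}([0,\infty)^3)$, for some $\theta\in(0,1]$, with $\mathtt F_p\to\mathtt F_1$ locally uniformly in $[0,\infty)^3$ as $p\downarrow1$, that $\frac{\beta_p}{p-1}\to\mathbf c\in[0,1]$ as $p\downarrow1$, and that $\mathtt F_1(r_0,t_0,\rho_0)>0$ for some $(r_0,t_0,\rho_0)\in(0,\infty)\times[1,\xi_1(1+\ell)]\times[0,\xi_2]$. Let $p_j\downarrow1$ and let $u_{p_j},y_{p_j},k_{p_j},G_{p_j}$ be as in the context. There exist $\delta\in(0,1)$ and $j_0\in\mathbb N$ such that $$\|y_{p_j}'\|_{L^\infty(0,r_0)}\le\delta^{1/(p_j-1)},\qquad\|y_{p_j}-1\|_{L^\infty(0,r_0)}\le r_0\,\delta^{1/(p_j-1)}$$ for every $j\ge j_0$. Consequently, $$u_{p_j}\to1\ \text{ in } C^1([-r_0,r_0]),$$ $$u_{p_j}^{p_j-1}\to1,\quad u_{p_j}^{-\beta_{p_j}}\to1\ \text{ in } C([-r_0,r_0]),$$ $$k_{p_j}\to\mathtt F_1(\cdot,1,0)\ \text{ in } C([0,r_0]).$$ Furthermore, with $G(t):=\int_0^t\mathtt F_1(s,1,0)\,ds$ for $t\in[0,r_0]$, $$G_{p_j}\to G\ \text{ in } C^1([0,r_0]),\qquad 0\le G(t)<1\ \text{ for every }t\in[0,r_0].$$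 For $$z_{p_j}(x):=|u_{p_j}'(x)|^{p_j-2}u_{p_j}'(x)=\operatorname{sign}(x)G_{p_j}(|x|),\qquad z_{p_j}(0):=0,$$ one has $$z_{p_j}\to z\ \text{ in } C^1([-r_0,r_0]),\qquad z(x)=\operatorname{sign}(x)G(|x|),\quad z(0)=0,$$ and $$z'(x)=\mathtt F_1(|x|,1,0),\qquad|z(x)|<1,\qquad x\in[-r_0,r_0].$$ Thus the limit $u\equiv1$ of $u_{p_j}$ on $(-r_0,r_0)$ satisfies $$\Delta_1u=\mathtt F_1(|x|,u,|u'|)=\mathtt F_1(|x|,1,0)\quad\text{in }(-r_0,r_0)$$ in the local sense defined in the context.
   Context: **One-dimensional setting.** Let $\ell\ge0$, $\xi_1\ge1$, $\xi_2>0$ be constants independent of $p$; put $\varphi(t):=\max\{\ell,t\}$, $U(t):=\xi_1(1+\varphi(t))$, $m_\xi:=\min\{\xi_1,\xi_2\}$. For each $p\in(1,2)$ let $0\le\beta_p\le p-1$ and $\mathtt F_p:[0,\infty)^3\to\mathbb R$. $\mathtt F_p$ is *one-dimensionally admissible* if (a) there is $\theta\in(0,1]$ with $\mathtt F_p\in C^{0,\theta}_{\mathrm{loc}}([0,\infty)^3)$, and $\mathtt F_p\ge0$; (b) for every $t\ge0$, $u\mapsto\mathtt F_p(t,u,s)$ is nondecreasing on $[1,U(t)]$ for every $s\in[0,\xi_2]$, and $s\mapsto\mathtt F_p(t,u,s)$ is nondecreasing on $[0,\xi_2]$ for every $u\in[1,U(t)]$; (c) $\int_0^\infty\mathtt F_p(t,U(t),\xi_2)\,dt\le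 m_\xi^{p-1}$. **Solutions.** For $p\in(1,2)$, $u_p(x)=y_p(|x|)$ is an even positive classical solution of $(|u'|^{p-2}u')'=\mathtt F_p(|x|,u,|u'|)u^{-\beta_p}$ on $\mathbb R$ (i.e. $u\in C^1(\mathbb R)$, $|u'|^{p-2}u'\in C^1(\mathbb R)$) with $y_p(0)=1$, $y_p'(0)=0$, $1\le y_p(t)\le U(t)$, $0\le y_p'(t)\le\xi_2$ for $t\ge0$ (such a solution exists when $\mathtt F_p$ is one-dimensionally admissible). Put $$k_p(t):=\mathtt F_p(t,y_p(t),y_p'(t))y_p(t)^{-\beta_p},\qquad G_p(t):=\int_0^t k_p(s)\,ds=y_p'(t)^{p-1}.$$ **1-Laplacian on an interval $I$.** For $z\in L^\infty_{\mathrm{loc}}(I)$ with $z'\in L^\infty_{\mathrm{loc}}(I)$ and $u\in BV_{\mathrm{loc}}(I)\cap L^\infty_{\mathrm{loc}}(I)$, $(z,Du)$ is the Radon measure given by $\langle(z,Du),\zeta\rangle=-\int_I u\zeta z'\,dx-\int_I uz\zeta'\,dx$, $\zeta\in C_c^\infty(I)$. For such $u$ and $f\in L^\infty_{\mathrm{loc}}(I)$, $\Delta_1u=f$ in $I$ (i.e. $-\Delta_1u=-f$) means: there is $z\in L^\infty_{\mathrm{loc}}(I)$ with $z'\in L^\infty_{\mathrm{loc}}(I)$, $z'=f$ in distributions on $I$, $|z|\le1$ a.e., and $(z,Du)=|Du|$ as Radon measures on $I$, where $|Du|$ is the total variation measure of $Du$. *)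

theory Defs
  imports "HOL-Analysis.Analysis" "HOL-Probability.Essential_Supremum"
begin

definition deriv_within :: "real set \<Rightarrow> (real \<Rightarrow> real) \<Rightarrow> real \<Rightarrow> real" where
  "deriv_within S f x = vector_derivative f (at x within S)"

text \<open>On a closed interval the derivatives at the end points are one-sided.\<close>

definition C1_on :: "real set \<Rightarrow> (real \<Rightarrow> real) \<Rightarrow> bool" where
  "C1_on S f \<longleftrightarrow> f differentiable_on S \<and> continuous_on S (deriv_within S f)"

definition converges_C0 :: "real set \<Rightarrow> (nat \<Rightarrow> real \<Rightarrow> real) \<Rightarrow> (real \<Rightarrow> real) \<Rightarrow> bool" where
  "converges_C0 K f g \<longleftrightarrow>
     (\<forall>j. continuous_on K (f j)) \<and> continuous_on K g \<and> uniform_limit K f g sequentially"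

definition converges_C1 :: "real set \<Rightarrow> (nat \<Rightarrow> real \<Rightarrow> real) \<Rightarrow> (real \<Rightarrow> real) \<Rightarrow> bool" where
  "converges_C1 K f g \<longleftrightarrow>
     (\<forall>j. C1_on K (f j)) \<and> C1_on K g \<and> uniform_limit K f g sequentially \<and>
     uniform_limit K (\<lambda>j. deriv_within K (f j)) (deriv_within K g) sequentially"

definition Linf_norm :: "real set \<Rightarrow> (real \<Rightarrow> real) \<Rightarrow> ereal" where
  "Linf_norm S f = esssup (lebesgue_on S) (\<lambda>x. ereal \<bar>f x\<bar>)"

definition holder_loc :: "real \<Rightarrow> 'a::metric_space set \<Rightarrow> ('a \<Rightarrow> real) \<Rightarrow> bool" where
  "holder_loc \<theta> S f \<longleftrightarrow>
     (\<forall>K. compact K \<and> K \<subseteq> S \<longrightarrow>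
        (\<exists>C. \<forall>x\<in>K. \<forall>y\<in>K. \<bar>f x - f y\<bar> \<le> C * dist x y powr \<theta>))"

definition octant :: "(real \<times> real \<times> real) set" where
  "octant = {0..} \<times> {0..} \<times> {0..}"

definition phi :: "real \<Rightarrow> real \<Rightarrow> real" where
  "phi l t = max l t"

definition upper :: "real \<Rightarrow> real \<Rightarrow> real \<Rightarrow> real" where
  "upper l \<xi>1 t = \<xi>1 * (1 + phi l t)"

text \<open>The integral condition is stated with the integral of nonnegative functions, so it
  includes the finiteness of the integral.\<close>

definition admissible_1d ::
    "real \<Rightarrow> real \<Rightarrow> real \<Rightarrow> real \<Rightarrow> (real \<times> real \<times> real \<Rightarrow> real) \<Rightarrow> bool" where
  "admissible_1d l \<xi>1 \<xi>2 p F \<longleftrightarrow>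
     (\<exists>\<theta>\<in>{0<..1}. holder_loc \<theta> octant F) \<and> (\<forall>w\<in>octant. F w \<ge> 0) \<and>
     (\<forall>t\<ge>0. (\<forall>s\<in>{0..\<xi>2}. mono_on {1..upper l \<xi>1 t} (\<lambda>u. F (t, u, s))) \<and>
            (\<forall>u\<in>{1..upper l \<xi>1 t}. mono_on {0..\<xi>2} (\<lambda>s. F (t, u, s)))) \<and>
     (\<integral>\<^sup>+t\<in>{0..}. ennreal (F (t, upper l \<xi>1 t, \<xi>2)) \<partial>lborel) \<le> ennreal (min \<xi>1 \<xi>2 powr (p - 1))"

text \<open>For \<open>v = 0\<close> the value is 0, although the exponent \<open>p - 2\<close> is negative for \<open>p < 2\<close>.\<close>

definition p_flux :: "real \<Rightarrow> real \<Rightarrow> real" where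
  "p_flux p v = \<bar>v\<bar> powr (p - 2) * v"

text \<open>The equation \<open>u x = y \<bar>x\<bar>\<close> makes \<open>u\<close> even. The profile \<open>y\<close> is only relevant on
  \<open>[0, \<infinity>)\<close>; its derivative at 0 is the right derivative.\<close>

definition even_solution ::
    "real \<Rightarrow> real \<Rightarrow> real \<Rightarrow> real \<Rightarrow> real \<Rightarrow> (real \<times> real \<times> real \<Rightarrow> real)
      \<Rightarrow> (real \<Rightarrow> real) \<Rightarrow> (real \<Rightarrow> real) \<Rightarrow> bool" where
  "even_solution l \<xi>1 \<xi>2 p \<beta> F u y \<longleftrightarrow>
     (\<forall>x. u x = y \<bar>x\<bar>) \<and> (\<forall>x. u x > 0) \<and>
     C1_on UNIV u \<and> C1_on UNIV (\<lambda>x. p_flux p (deriv u x)) \<and>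
     (\<forall>x. deriv (\<lambda>x. p_flux p (deriv u x)) x = F (\<bar>x\<bar>, u x, \<bar>deriv u x\<bar>) * u x powr (- \<beta>)) \<and>
     y 0 = 1 \<and> deriv_within {0..} y 0 = 0 \<and>
     (\<forall>t\<ge>0. 1 \<le> y t \<and> y t \<le> upper l \<xi>1 t \<and>
            0 \<le> deriv_within {0..} y t \<and> deriv_within {0..} y t \<le> \<xi>2)"

definition k_fun :: "real \<Rightarrow> (real \<times> real \<times> real \<Rightarrow> real) \<Rightarrow> (real \<Rightarrow> real) \<Rightarrow> real \<Rightarrow> real" where
  "k_fun \<beta> F y t = F (t, y t, deriv_within {0..} y t) * y t powr (- \<beta>)"

definition G_fun :: "real \<Rightarrow> (real \<times> real \<times> real \<Rightarrow> real) \<Rightarrow> (real \<Rightarrow> real) \<Rightarrow> real \<Rightarrow> real" where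
  "G_fun \<beta> F y t = integral {0..t} (k_fun \<beta> F y)"

definition G_lim :: "(real \<times> real \<times> real \<Rightarrow> real) \<Rightarrow> real \<Rightarrow> real" where
  "G_lim F t = integral {0..t} (\<lambda>s. F (s, 1, 0))"

definition test_functions :: "real set \<Rightarrow> (real \<Rightarrow> real) set" where
  "test_functions I =
     {\<zeta>. (\<forall>n x. ((deriv ^^ n) \<zeta>) differentiable (at x)) \<and>
         compact (closure {x. \<zeta> x \<noteq> 0}) \<and> closure {x. \<zeta> x \<noteq> 0} \<subseteq> I}"

definition L1_loc :: "real set \<Rightarrow> (real \<Rightarrow> real) \<Rightarrow> bool" where
  "L1_loc I f \<longleftrightarrow> (\<forall>K. compact K \<and> K \<subseteq> I \<longrightarrow> integrable (lebesgue_on K) f)"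

definition Linf_loc :: "real set \<Rightarrow> (real \<Rightarrow> real) \<Rightarrow> bool" where
  "Linf_loc I f \<longleftrightarrow>
     f \<in> borel_measurable (lebesgue_on I) \<and>
     (\<forall>K. compact K \<and> K \<subseteq> I \<longrightarrow> Linf_norm K f < \<infinity>)"

definition weak_deriv :: "real set \<Rightarrow> (real \<Rightarrow> real) \<Rightarrow> (real \<Rightarrow> real) \<Rightarrow> bool" where
  "weak_deriv I f g \<longleftrightarrow>
     (\<forall>\<zeta>\<in>test_functions I.
        (\<integral>x. f x * deriv \<zeta> x \<partial>lebesgue_on I) = - (\<integral>x. g x * \<zeta> x \<partial>lebesgue_on I))"

text \<open>On an open subset of the line a Borel measure that is finite on compact sets is Radon.
  A signed Radon measure is represented as a difference \<open>P - N\<close> of two positive ones; its value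
  is meaningful on Borel sets that are contained in a compact subset of \<open>I\<close>.\<close>

definition radon_measure_on :: "real set \<Rightarrow> real measure \<Rightarrow> bool" where
  "radon_measure_on I \<mu> \<longleftrightarrow>
     sets \<mu> = sets (restrict_space borel I) \<and>
     (\<forall>K. compact K \<and> K \<subseteq> I \<longrightarrow> emeasure \<mu> K < \<infinity>)"

definition distr_deriv :: "real set \<Rightarrow> (real \<Rightarrow> real) \<Rightarrow> real measure \<Rightarrow> real measure \<Rightarrow> bool" where
  "distr_deriv I u P N \<longleftrightarrow>
     radon_measure_on I P \<and> radon_measure_on I N \<and>
     (\<forall>\<zeta>\<in>test_functions I.
        (\<integral>x. u x * deriv \<zeta> x \<partial>lebesgue_on I) = - ((\<integral>x. \<zeta> x \<partial>P) - (\<integral>x. \<zeta> x \<partial>N)))"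

definition BV_loc :: "real set \<Rightarrow> (real \<Rightarrow> real) \<Rightarrow> bool" where
  "BV_loc I u \<longleftrightarrow> L1_loc I u \<and> (\<exists>P N. distr_deriv I u P N)"

text \<open>The total variation measure of \<open>P - N\<close>. The supremum runs over finite disjoint families of
  Borel subsets of \<open>B\<close> that are relatively compact in \<open>I\<close>.\<close>

definition total_variation :: "real set \<Rightarrow> real measure \<Rightarrow> real measure \<Rightarrow> real measure" where
  "total_variation I P N =
     measure_of I (sets (restrict_space borel I))
       (\<lambda>B. SUP \<A> \<in> {\<A>. finite \<A> \<and> disjoint \<A> \<and>
                         (\<forall>A\<in>\<A>. A \<in> sets borel \<and> A \<subseteq> B \<and> (\<exists>K. compact K \<and> A \<subseteq> K \<and> K \<subseteq> I))}.
              \<Sum>A\<in>\<A>. ennreal \<bar>measure P A - measure N A\<bar>)"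

text \<open>The distribution \<open>(z, Du)\<close>, where \<open>z'\<close> is the weak derivative of \<open>z\<close>.\<close>

definition pairing ::
    "real set \<Rightarrow> (real \<Rightarrow> real) \<Rightarrow> (real \<Rightarrow> real) \<Rightarrow> (real \<Rightarrow> real) \<Rightarrow> (real \<Rightarrow> real) \<Rightarrow> real" where
  "pairing I z z' u \<zeta> =
     - (\<integral>x. u x * \<zeta> x * z' x \<partial>lebesgue_on I) - (\<integral>x. u x * z x * deriv \<zeta> x \<partial>lebesgue_on I)"

text \<open>\<open>\<Delta>\<^sub>1 u = f\<close> in \<open>I\<close>. Both \<open>z'\<close> and \<open>f\<close> are weak derivatives of \<open>z\<close>, which expresses
  that \<open>z' = f\<close> in the sense of distributions.\<close>

definition one_laplace_eq :: "real set \<Rightarrow> (real \<Rightarrow> real) \<Rightarrow> (real \<Rightarrow> real) \<Rightarrow> bool" where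
  "one_laplace_eq I u f \<longleftrightarrow>
     BV_loc I u \<and> Linf_loc I u \<and> Linf_loc I f \<and>
     (\<exists>z z'. Linf_loc I z \<and> Linf_loc I z' \<and> weak_deriv I z z' \<and> weak_deriv I z f \<and>
             (AE x in lebesgue_on I. \<bar>z x\<bar> \<le> 1) \<and>
             (\<exists>P N. distr_deriv I u P N \<and>
                (\<forall>\<zeta>\<in>test_functions I. pairing I z z' u \<zeta> = (\<integral>x. \<zeta> x \<partial>total_variation I P N))))"

end

theory Submission
  imports Defs "HOL-Real_Asymp.Real_Asymp"
begin

text \<open>The flux \<open>G\<^sub>p = (y\<^sub>p')\<^bsup>p-1\<^esup>\<close> on \<open>[0, r\<^sub>0]\<close> is bounded by the integral of the envelope
  \<open>F\<^sub>p (t, U t, \<xi>\<^sub>2)\<close> over \<open>[0, r\<^sub>0]\<close>. The whole integral is at most \<open>m\<^sub>\<xi>\<^bsup>p-1\<^esup>\<close>, which tends to 1,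
  and since \<open>F\<^sub>1 > 0\<close> at one point with first coordinate \<open>r\<^sub>0\<close>, monotonicity gives the envelope a mass
  bounded below just to the right of \<open>r\<^sub>0\<close>. Hence \<open>G\<^sub>p \<le> \<delta> < 1\<close> on \<open>[0, r\<^sub>0]\<close> for \<open>p\<close> near 1, and taking
  the root of order \<open>p - 1\<close> makes \<open>y\<^sub>p'\<close> exponentially small. All the convergence statements follow from
  this decay, and the limit flux has modulus at most \<open>\<delta>\<close>, so it is a calibrating field for the
  constant 1.\<close>

section \<open>Regularity on closed intervals\<close>

text \<open>A Hoelder constant is available only on compact sets. A convergent sequence together
  with its limit is compact, so sequential continuity can be read off from the estimate on that
  set.\<close>

lemma holder_loc_continuous_on:
  fixes f :: "'a::heine_borel \<Rightarrow> real"
  assumes "holder_loc \<theta> S f" and "\<theta> > 0"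
  shows "continuous_on S f"
  unfolding continuous_on_sequentially
proof (intro allI ballI impI, elim conjE)
  fix X a assume a: "a \<in> S" and X: "\<forall>n. X n \<in> S" and lim: "X \<longlonglongrightarrow> a"
  let ?K = "insert a (range X)"
  have "compact ?K" "?K \<subseteq> S"
    using compact_sequence_with_limit[OF lim] a X by auto
  then obtain C where C: "\<And>x y. x \<in> ?K \<Longrightarrow> y \<in> ?K \<Longrightarrow> \<bar>f x - f y\<bar> \<le> C * dist x y powr \<theta>"
    using assms(1) unfolding holder_loc_def by meson
  have "(\<lambda>n. C * dist (X n) a powr \<theta>) \<longlonglongrightarrow> C * 0 powr \<theta>"
    using lim \<open>\<theta> > 0\<close> unfolding tendsto_dist_iff[of X]
    by (intro tendsto_intros tendsto_powr2) auto
  then have "(\<lambda>n. C * dist (X n) a powr \<theta>) \<longlonglongrightarrow> 0" by simp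
  then have "(\<lambda>n. f (X n) - f a) \<longlonglongrightarrow> 0"
    by (rule Lim_null_comparison[rotated]) (auto intro!: always_eventually C)
  then show "(f \<circ> X) \<longlonglongrightarrow> f a"
    using LIM_zero_iff by (auto simp: o_def)
qed

text \<open>\<open>vector_derivative\<close> is a choice among all derivatives; it is determined
  only at limit points of \<open>S\<close>, hence the condition on the filter.\<close>

lemma deriv_within_eq:
  assumes "(f has_real_derivative d) (at x within S)" and "at x within S \<noteq> bot"
  shows "deriv_within S f x = d"
  using assms by (simp add: deriv_within_def has_real_derivative_iff_has_vector_derivative
      vector_derivative_within)

lemma deriv_within_Icc_eq:
  assumes "(f has_real_derivative d) (at x within {a..b})" and "x \<in> {a..b}" and "a < b"
  shows "deriv_within {a..b} f x = d"
  using assms by (intro deriv_within_eq) (auto simp: trivial_limit_within islimpt_Icc)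

lemma C1_on_UNIV_D:
  assumes "C1_on UNIV f"
  shows "(f has_real_derivative deriv f x) (at x)" and "continuous_on UNIV (deriv f)"
proof -
  have d: "f differentiable (at x)" for x
    using assms unfolding C1_on_def differentiable_on_def by auto
  then show D: "(f has_real_derivative deriv f x) (at x)" for x
    using DERIV_deriv_iff_real_differentiable by blast
  have "deriv_within UNIV f = deriv f"
    using D by (auto intro!: deriv_within_eq simp: fun_eq_iff)
  then show "continuous_on UNIV (deriv f)"
    using assms unfolding C1_on_def by simp
qed

lemma C1_on_Icc_I:
  assumes "\<And>x. x \<in> {a..b} \<Longrightarrow> (f has_real_derivative f' x) (at x within {a..b})"
    and "continuous_on {a..b} f'" and "a < b"
  shows "C1_on {a..b} f"
proof -
  have "continuous_on {a..b} (deriv_within {a..b} f)"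
    using assms(2) by (rule continuous_on_eq) (simp add: deriv_within_Icc_eq[OF assms(1)] assms(3))
  then show ?thesis
    using assms(1) unfolding C1_on_def differentiable_on_def
    by (meson differentiableI has_field_derivative_imp_has_derivative)
qed

text \<open>Continuity of \<open>g'\<close> is inherited from the \<open>f' j\<close> through
  uniform convergence, so only the approximating derivatives have to be known continuous.\<close>

lemma converges_C1_Icc_I:
  assumes "a < b"
    and "\<And>j x. x \<in> {a..b} \<Longrightarrow> (f j has_real_derivative f' j x) (at x within {a..b})"
    and "\<And>x. x \<in> {a..b} \<Longrightarrow> (g has_real_derivative g' x) (at x within {a..b})"
    and "\<And>j. continuous_on {a..b} (f' j)"
    and "uniform_limit {a..b} f g sequentially"
    and "uniform_limit {a..b} f' g' sequentially"
  shows "converges_C1 {a..b} f g"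
proof -
  have "continuous_on {a..b} g'"
    using assms(4,6) by (intro uniform_limit_theorem[where f=f' and F=sequentially]) auto
  moreover have "uniform_limit {a..b} (\<lambda>j. deriv_within {a..b} (f j)) (deriv_within {a..b} g) sequentially"
    using assms(6)
    by (subst uniform_limit_cong'[where g=f' and i=g'])
       (simp_all add: deriv_within_Icc_eq[OF assms(2)] deriv_within_Icc_eq[OF assms(3)] assms(1))
  ultimately show ?thesis
    using assms C1_on_Icc_I[OF assms(2)] C1_on_Icc_I[OF assms(3)] unfolding converges_C1_def by blast
qed

section \<open>Essential bounds, test functions and weak derivatives\<close>

lemma Linf_norm_le:
  assumes "S \<in> sets borel" and "continuous_on S f" and "\<And>x. x \<in> S \<Longrightarrow> \<bar>f x\<bar> \<le> C"
  shows "Linf_norm S f \<le> ereal C"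
  unfolding Linf_norm_def
proof (rule esssup_I)
  have "f \<in> borel_measurable (lebesgue_on S)"
    using assms by (intro continuous_imp_measurable_on_sets_lebesgue) auto
  then show "(\<lambda>x. ereal \<bar>f x\<bar>) \<in> borel_measurable (lebesgue_on S)"
    by measurable
  show "AE x in lebesgue_on S. ereal \<bar>f x\<bar> \<le> ereal C"
    using assms by (intro AE_I2) auto
qed

lemma Linf_loc_continuous_on:
  assumes "I \<in> sets borel" and "continuous_on I f"
  shows "Linf_loc I f"
  unfolding Linf_loc_def
proof (intro conjI allI impI)
  show "f \<in> borel_measurable (lebesgue_on I)"
    using assms by (intro continuous_imp_measurable_on_sets_lebesgue) auto
  fix K assume K: "compact K \<and> K \<subseteq> I"
  then have cont: "continuous_on K f"
    using assms continuous_on_subset by blast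
  then have "bounded (f ` K)"
    using K compact_continuous_image compact_imp_bounded by blast
  then obtain C where "\<And>x. x \<in> K \<Longrightarrow> \<bar>f x\<bar> \<le> C"
    by (auto simp: bounded_iff)
  then have "Linf_norm K f \<le> ereal C"
    using K cont by (intro Linf_norm_le) (auto simp: borel_compact)
  also have "\<dots> < \<infinity>" by simp
  finally show "Linf_norm K f < \<infinity>" .
qed

text \<open>Passes from the Lebesgue integrals over \<open>I\<close> in the definitions to gauge
  integrals over a compact interval, where the fundamental theorem of calculus applies.\<close>

lemma integral_lebesgue_on_vanishing:
  fixes f :: "real \<Rightarrow> real"
  assumes "I \<in> sets lebesgue" and "{c..d} \<subseteq> I" and "continuous_on {c..d} f"
    and "\<And>x. x \<in> I - {c..d} \<Longrightarrow> f x = 0"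
  shows "(\<integral>x. f x \<partial>lebesgue_on I) = integral {c..d} f"
proof -
  have "(\<integral>x. f x \<partial>lebesgue_on I) = (\<integral>x. (if x \<in> I then f x else 0) \<partial>lebesgue)"
    using assms(1) by (simp add: Lebesgue_Measure.integral_restrict_UNIV)
  also have "(\<lambda>x. if x \<in> I then f x else 0) = (\<lambda>x. if x \<in> {c..d} then f x else 0)"
    using assms by (auto simp: fun_eq_iff)
  also have "(\<integral>x. (if x \<in> {c..d} then f x else 0) \<partial>lebesgue) = (\<integral>x. f x \<partial>lebesgue_on {c..d})"
    by (rule Lebesgue_Measure.integral_restrict_UNIV) simp
  also have "\<dots> = integral {c..d} f"
    using assms by (intro lebesgue_integral_eq_integral continuous_imp_integrable_real) auto
  finally show ?thesis .
qed

text \<open>The compact support keeps a positive distance from \<open>a\<close> and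
  \<open>b\<close>. Excluding only the open interval \<open>{c<..<d}\<close> makes \<zeta> vanish at
  \<open>c\<close> and \<open>d\<close> themselves, which removes the boundary terms in an
  integration by parts.\<close>

lemma test_function_support:
  assumes "\<zeta> \<in> test_functions {a<..<b}" and "a < b"
  obtains c d where "a < c" "c < d" "d < b" "\<And>x. x \<notin> {c<..<d} \<Longrightarrow> \<zeta> x = 0 \<and> deriv \<zeta> x = 0"
proof -
  define K where "K = closure {x. \<zeta> x \<noteq> 0}"
  have K: "compact K" "K \<subseteq> {a<..<b}" "open (- K)"
    using assms unfolding test_functions_def K_def by auto
  have \<zeta>0: "\<zeta> x = 0" if "x \<notin> K" for x
    using that closure_subset[of "{x. \<zeta> x \<noteq> 0}"] unfolding K_def by blast
  have d0: "deriv \<zeta> x = 0" if "x \<notin> K" for x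
  proof -
    have "(\<zeta> has_real_derivative 0) (at x)"
      by (rule has_field_derivative_transform_within_open[where f="\<lambda>_. 0" and S="- K"])
         (use that K(3) \<zeta>0 in simp_all)
    then show ?thesis by (rule DERIV_imp_deriv)
  qed
  have "\<exists>s t. a < s \<and> s \<le> t \<and> t < b \<and> K \<subseteq> {s..t}"
  proof (cases "K = {}")
    case True
    then show ?thesis using dense[OF assms(2)] by auto
  next
    case False
    then obtain s t where "s \<in> K" "t \<in> K" "\<forall>x\<in>K. s \<le> x" "\<forall>x\<in>K. x \<le> t"
      using K(1) compact_attains_inf compact_attains_sup by metis
    then show ?thesis using K(2) by (intro exI[of _ s] exI[of _ t]) auto
  qed
  then obtain s t where st: "a < s" "s \<le> t" "t < b" "K \<subseteq> {s..t}" by blast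
  show thesis
  proof
    \<comment> \<open>Midpoints of the gaps on either side of the support; they are distinct even
      when \<open>s = t\<close>.\<close>
    show "a < (a + s) / 2" "(a + s) / 2 < (t + b) / 2" "(t + b) / 2 < b"
      using st by auto
    fix x assume "x \<notin> {(a + s) / 2<..<(t + b) / 2}"
    then have "x \<notin> K" using st by (auto simp: subset_eq not_less)
    then show "\<zeta> x = 0 \<and> deriv \<zeta> x = 0" using \<zeta>0 d0 by blast
  qed
qed

lemma test_function_derivatives:
  assumes "\<zeta> \<in> test_functions I"
  shows "(\<zeta> has_real_derivative deriv \<zeta> x) (at x)" and "continuous_on S \<zeta>" and "continuous_on S (deriv \<zeta>)"
proof -
  have "((deriv ^^ n) \<zeta>) differentiable (at x)" for n x
    using assms unfolding test_functions_def by blast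
  from this[of 0] this[of 1] have d: "\<zeta> differentiable (at x)" "deriv \<zeta> differentiable (at x)" for x
    by simp_all
  show "(\<zeta> has_real_derivative deriv \<zeta> x) (at x)"
    using d(1)[of x] by (simp add: DERIV_deriv_iff_real_differentiable)
  show "continuous_on S \<zeta>" "continuous_on S (deriv \<zeta>)"
    using d by (auto intro!: continuous_at_imp_continuous_on differentiable_imp_continuous_within)
qed

text \<open>Integration by parts: the derivative of \<open>f * \<zeta>\<close> has integral 0 over
  an interval at whose ends \<zeta> vanishes. If the interval is empty, both integrals are
  0.\<close>

lemma weak_deriv_classical:
  assumes "\<And>x. x \<in> {a<..<b} \<Longrightarrow> (f has_real_derivative g x) (at x)"
    and "continuous_on {a<..<b} g"
  shows "weak_deriv {a<..<b} f g"
proof (cases "a < b")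
  case False
  then show ?thesis
    by (simp add: weak_deriv_def)
next
  case True
  show ?thesis
    unfolding weak_deriv_def
  proof
    fix \<zeta> assume \<zeta>: "\<zeta> \<in> test_functions {a<..<b}"
    from test_function_support[OF this True] obtain c d
      where cd: "a < c" "c < d" "d < b" and zero: "\<And>x. x \<notin> {c<..<d} \<Longrightarrow> \<zeta> x = 0 \<and> deriv \<zeta> x = 0"
      by blast
    note \<zeta>' = test_function_derivatives[OF \<zeta>]
    have sub: "{c..d} \<subseteq> {a<..<b}" using cd by auto
    have "continuous_on {a<..<b} f"
      using assms(1) by (meson DERIV_continuous_on has_field_derivative_at_within)
    then have cont: "continuous_on {c..d} f" "continuous_on {c..d} g"
      using sub assms(2) continuous_on_subset by blast+
    have "((\<lambda>x. f x * deriv \<zeta> x + g x * \<zeta> x) has_integral (f d * \<zeta> d - f c * \<zeta> c)) {c..d}"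
      using cd sub assms(1) \<zeta>'(1)
      by (intro fundamental_theorem_of_calculus)
         (auto intro!: derivative_eq_intros simp flip: has_real_derivative_iff_has_vector_derivative
            intro: has_field_derivative_at_within)
    then have "integral {c..d} (\<lambda>x. f x * deriv \<zeta> x + g x * \<zeta> x) = 0"
      using zero by (simp add: integral_unique)
    then have "integral {c..d} (\<lambda>x. f x * deriv \<zeta> x) = - integral {c..d} (\<lambda>x. g x * \<zeta> x)"
      using cont \<zeta>'
      by (subst (asm) Henstock_Kurzweil_Integration.integral_add)
         (auto intro!: integrable_continuous_real continuous_intros)
    moreover have "(\<integral>x. f x * deriv \<zeta> x \<partial>lebesgue_on {a<..<b}) = integral {c..d} (\<lambda>x. f x * deriv \<zeta> x)"
      using sub zero cont \<zeta>' by (intro integral_lebesgue_on_vanishing) (auto intro!: continuous_intros)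
    moreover have "(\<integral>x. g x * \<zeta> x \<partial>lebesgue_on {a<..<b}) = integral {c..d} (\<lambda>x. g x * \<zeta> x)"
      using sub zero cont \<zeta>' by (intro integral_lebesgue_on_vanishing) (auto intro!: continuous_intros)
    ultimately show "(\<integral>x. f x * deriv \<zeta> x \<partial>lebesgue_on {a<..<b}) =
        - (\<integral>x. g x * \<zeta> x \<partial>lebesgue_on {a<..<b})"
      by simp
  qed
qed

section \<open>The 1-Laplacian of a constant\<close>

text \<open>Every summand has the form \<open>\<bar>measure P A - measure P A\<bar>\<close>. An
  empty index set is harmless because the supremum of nothing is 0 in
  \<open>ennreal\<close>.\<close>

lemma total_variation_diff_self: "total_variation I P P = null_measure (restrict_space borel I)"
proof -
  have "(SUP \<A>\<in>X. 0 :: ennreal) = 0" for X :: "real set set set"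
    by (cases "X = {}") (auto simp: bot_ennreal)
  then have "total_variation I P P = measure_of I (sets (restrict_space borel I)) (\<lambda>_. 0)"
    by (simp add: total_variation_def)
  also have "\<dots> = null_measure (restrict_space borel I)"
    by (simp add: null_measure_def space_restrict_space)
  finally show ?thesis .
qed

text \<open>Since \<open>Du = 0\<close>, the pairing reduces to the definition of the weak derivative of \<open>z\<close>.\<close>

lemma one_laplace_eq_const:
  assumes deriv: "\<And>x. x \<in> {a<..<b} \<Longrightarrow> (z has_real_derivative f x) (at x)"
    and cont: "continuous_on {a<..<b} f"
    and le1: "\<And>x. x \<in> {a<..<b} \<Longrightarrow> \<bar>z x\<bar> \<le> 1"
  shows "one_laplace_eq {a<..<b} (\<lambda>_. C) f"
proof -
  let ?I = "{a<..<b}"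
  let ?N = "null_measure (restrict_space borel ?I)"
  \<comment> \<open>The derivative of a constant is represented by taking the null measure for both
    the positive and the negative part.\<close>
  have null: "distr_deriv ?I (\<lambda>_. C) ?N ?N"
  proof -
    have "weak_deriv ?I (\<lambda>_. C) (\<lambda>_. 0)"
      by (rule weak_deriv_classical) auto
    then show ?thesis
      unfolding distr_deriv_def weak_deriv_def by (auto simp: radon_measure_on_def)
  qed
  have "L1_loc ?I (\<lambda>_. C)"
    unfolding L1_loc_def
  proof (intro allI impI)
    fix K :: "real set" assume "compact K \<and> K \<subseteq> ?I"
    then show "integrable (lebesgue_on K) (\<lambda>_. C)"
      by (intro finite_measure.integrable_const finite_measure_lebesgue_on lmeasurable_compact) auto
  qed
  then have BV: "BV_loc ?I (\<lambda>_. C)"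
    using null unfolding BV_loc_def by blast
  have "continuous_on ?I z"
    using deriv by (meson DERIV_continuous_on has_field_derivative_at_within)
  then have Linf: "Linf_loc ?I (\<lambda>_. C)" "Linf_loc ?I f" "Linf_loc ?I z"
    using cont by (auto intro!: Linf_loc_continuous_on)
  have weak: "weak_deriv ?I z f"
    by (rule weak_deriv_classical[OF deriv cont])
  have "pairing ?I z f (\<lambda>_. C) \<zeta> = 0" if "\<zeta> \<in> test_functions ?I" for \<zeta>
    using weak that unfolding weak_deriv_def pairing_def
    by (simp add: mult.assoc mult.commute[of "\<zeta> _"])
  then have "\<forall>\<zeta>\<in>test_functions ?I. pairing ?I z f (\<lambda>_. C) \<zeta> = (\<integral>x. \<zeta> x \<partial>total_variation ?I ?N ?N)"
    by (simp add: total_variation_diff_self)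
  moreover have "AE x in lebesgue_on ?I. \<bar>z x\<bar> \<le> 1"
    using le1 by (intro AE_I2) auto
  ultimately show ?thesis
    unfolding one_laplace_eq_def using BV Linf weak null by blast
qed

section \<open>A solution at one fixed exponent\<close>

lemma p_flux_nonneg: "v \<ge> 0 \<Longrightarrow> p_flux q v = v powr (q - 1)"
  using powr_mult_base[of v "q - 2"] by (simp add: p_flux_def mult.commute)

lemma p_flux_minus: "p_flux q (- v) = - p_flux q v"
  by (simp add: p_flux_def)

locale solution_1d =
  fixes l \<xi>1 \<xi>2 q \<beta> :: real and F :: "real \<times> real \<times> real \<Rightarrow> real" and u y :: "real \<Rightarrow> real"
  assumes l: "l \<ge> 0" and \<xi>1: "\<xi>1 \<ge> 1" and \<xi>2: "\<xi>2 > 0" and q: "q \<in> {1<..<2}" and \<beta>: "0 \<le> \<beta>" "\<beta> \<le> q - 1"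
    and adm: "admissible_1d l \<xi>1 \<xi>2 q F"
    and sol: "even_solution l \<xi>1 \<xi>2 q \<beta> F u y"
begin

abbreviation "y' \<equiv> deriv_within {0..} y"
abbreviation "k \<equiv> k_fun \<beta> F y"
abbreviation "G \<equiv> G_fun \<beta> F y"
abbreviation "envelope \<equiv> \<lambda>t. F (t, upper l \<xi>1 t, \<xi>2)"

lemma F_nonneg: "w \<in> octant \<Longrightarrow> 0 \<le> F w"
  using adm unfolding admissible_1d_def by blast

lemma F_continuous: "continuous_on octant F"
  using adm unfolding admissible_1d_def by (auto intro: holder_loc_continuous_on)

text \<open>The first bound does not depend on \<open>t\<close>: a value of at most
  \<open>\<xi>1 * (1 + l)\<close>, such as \<open>t0\<close> in the theorem, lies below the upper
  barrier at every \<open>t\<close>. This is what lets positivity at one point be compared with the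
  envelope.\<close>

lemma upper_ge: "upper l \<xi>1 t \<ge> \<xi>1 * (1 + l)" "upper l \<xi>1 t \<ge> 1"
proof -
  show 1: "upper l \<xi>1 t \<ge> \<xi>1 * (1 + l)"
    using \<xi>1 by (simp add: upper_def phi_def)
  have "1 * 1 \<le> \<xi>1 * (1 + l)"
    using \<xi>1 l by (intro mult_mono) auto
  with 1 show "upper l \<xi>1 t \<ge> 1" by simp
qed

lemma F_mono:
  assumes "t \<ge> 0" "1 \<le> a" "a \<le> b" "b \<le> upper l \<xi>1 t" "0 \<le> s" "s \<le> r" "r \<le> \<xi>2"
  shows "F (t, a, s) \<le> F (t, b, r)"
proof -
  have "mono_on {1..upper l \<xi>1 t} (\<lambda>u. F (t, u, s))" "mono_on {0..\<xi>2} (\<lambda>s. F (t, b, s))"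
    using adm assms unfolding admissible_1d_def by auto
  then have "F (t, a, s) \<le> F (t, b, s)" "F (t, b, s) \<le> F (t, b, r)"
    using assms by (auto elim!: mono_onD)
  then show ?thesis by simp
qed

lemma u_eq: "u x = y \<bar>x\<bar>"
  and y0: "y 0 = 1" and y'0: "y' 0 = 0"
  and flux_deriv_eq: "deriv (\<lambda>x. p_flux q (deriv u x)) x = F (\<bar>x\<bar>, u x, \<bar>deriv u x\<bar>) * u x powr (- \<beta>)"
  using sol unfolding even_solution_def by auto

lemma y_bounds:
  assumes "t \<ge> 0" shows "1 \<le> y t" "y t \<le> upper l \<xi>1 t" "0 \<le> y' t" "y' t \<le> \<xi>2"
  using sol assms unfolding even_solution_def by auto

lemma u_deriv: "(u has_real_derivative deriv u x) (at x)"
  and u_deriv_continuous: "continuous_on S (deriv u)"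
  using sol C1_on_UNIV_D[of u] unfolding even_solution_def by (auto intro: continuous_on_subset)

text \<open>\<open>y\<close> is prescribed by \<open>u\<close> only on the half-line, where the two
  agree, so the one-sided derivative of \<open>y\<close> is the two-sided derivative of
  \<open>u\<close>.\<close>

lemma y_deriv:
  assumes "t \<ge> 0"
  shows "(y has_real_derivative deriv u t) (at t within {0..})" and "y' t = deriv u t"
proof -
  show d: "(y has_real_derivative deriv u t) (at t within {0..})"
    using assms
    by (intro has_field_derivative_transform_within[OF has_field_derivative_at_within[OF u_deriv], of 1])
       (auto simp: u_eq)
  have "at t within {0..} \<noteq> bot"
    using assms islimpt_subset[of t "{t..t+1}" "{0..}"] by (simp add: trivial_limit_within islimpt_Icc)
  then show "y' t = deriv u t"
    using d by (intro deriv_within_eq)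
qed

text \<open>The derivative of an even function is odd. At 0 the convention \<open>sgn 0 = 0\<close>
  agrees with \<open>y' 0 = 0\<close>.\<close>

lemma deriv_u: "deriv u x = sgn x * y' \<bar>x\<bar>"
proof (cases "x \<ge> 0")
  case True
  then show ?thesis using y_deriv(2)[of x] y'0 by (cases "x = 0") auto
next
  case False
  have "((\<lambda>x. u (- x)) has_real_derivative - deriv u (- x)) (at x)"
    using u_deriv[of "- x"] by (simp only: DERIV_mirror)
  moreover have "(\<lambda>x. u (- x)) = u" by (simp add: u_eq fun_eq_iff)
  ultimately have "deriv u x = - deriv u (- x)" by (metis DERIV_imp_deriv)
  then show ?thesis using False y_deriv(2)[of "-x"] by simp
qed

lemma flux_deriv: "((\<lambda>x. p_flux q (deriv u x)) has_real_derivative k \<bar>x\<bar>) (at x)"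
proof -
  have "((\<lambda>x. p_flux q (deriv u x)) has_real_derivative deriv (\<lambda>x. p_flux q (deriv u x)) x) (at x)"
    using sol C1_on_UNIV_D(1) unfolding even_solution_def by blast
  moreover have "\<bar>deriv u x\<bar> = y' \<bar>x\<bar>"
    using y_bounds(3)[of "\<bar>x\<bar>"] y'0 by (cases "x = 0") (auto simp: deriv_u abs_mult abs_sgn_eq)
  ultimately show ?thesis
    by (simp add: flux_deriv_eq u_eq k_fun_def)
qed

lemma y_continuous: "continuous_on {0..} y"
  using y_deriv(1) by (rule DERIV_continuous_on) simp

lemma y'_continuous: "continuous_on {0..} y'"
  using u_deriv_continuous by (rule continuous_on_eq) (simp add: y_deriv(2))

lemma k_continuous: "continuous_on {0..} k"
  unfolding k_fun_def using y_bounds y_continuous y'_continuous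
  by (intro continuous_intros continuous_on_compose2[OF F_continuous]) (force simp: octant_def)+

lemma envelope_continuous: "continuous_on {0..} envelope"
proof (rule continuous_on_compose2[OF F_continuous])
  show "continuous_on {0..} (\<lambda>t. (t, upper l \<xi>1 t, \<xi>2))"
    unfolding upper_def phi_def by (intro continuous_intros)
  show "(\<lambda>t. (t, upper l \<xi>1 t, \<xi>2)) ` {0..} \<subseteq> octant"
    using order_trans[OF zero_le_one upper_ge(2)] \<xi>2 by (auto simp: octant_def)
qed

text \<open>Since \<open>y \<ge> 1\<close> and \<open>\<beta> \<ge> 0\<close>, the factor
  \<open>y t powr (- \<beta>)\<close> is at most 1; monotonicity of \<open>F\<close> in both
  arguments then moves them up to their a priori bounds.\<close>

lemma k_bounds:
  assumes "t \<ge> 0" shows "0 \<le> k t" "k t \<le> envelope t"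
proof -
  note b = y_bounds[OF assms]
  have F: "0 \<le> F (t, y t, y' t)"
    using b assms by (intro F_nonneg) (auto simp: octant_def)
  then show "0 \<le> k t" by (simp add: k_fun_def)
  have "y t powr (- \<beta>) \<le> 1"
    using b \<beta> powr_mono[of "-\<beta>" 0 "y t"] by simp
  then have "k t \<le> F (t, y t, y' t)"
    using F by (simp add: k_fun_def mult_left_le)
  also have "\<dots> \<le> envelope t"
    using b assms upper_ge by (intro F_mono) auto
  finally show "k t \<le> envelope t" .
qed

text \<open>The equation is integrated from 0, where the flux vanishes. The formula on the whole
  line follows because the flux is an odd function of an odd derivative.\<close>

lemma flux_eq:
  shows "t \<ge> 0 \<Longrightarrow> G t = y' t powr (q - 1)" and "p_flux q (deriv u x) = sgn x * G \<bar>x\<bar>"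
proof -
  have flux: "p_flux q (deriv u t) = y' t powr (q - 1)" if "t \<ge> 0" for t
    using that y_bounds(3)[of t] by (simp add: p_flux_nonneg flip: y_deriv(2))
  show *: "G t = y' t powr (q - 1)" if "t \<ge> 0" for t
  proof -
    have "(k has_integral (p_flux q (deriv u t) - p_flux q (deriv u 0))) {0..t}"
    proof (rule fundamental_theorem_of_calculus)
      fix x assume "x \<in> {0..t}"
      then show "((\<lambda>x. p_flux q (deriv u x)) has_vector_derivative k x) (at x within {0..t})"
        using has_field_derivative_at_within[OF flux_deriv[of x], of "{0..t}"]
        by (simp add: has_real_derivative_iff_has_vector_derivative)
    qed (use that in simp)
    then show ?thesis
      using flux[of t] flux[of 0] that y'0 q by (simp add: G_fun_def integral_unique)
  qed
  show "p_flux q (deriv u x) = sgn x * G \<bar>x\<bar>"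
    using flux[of "\<bar>x\<bar>"] *[of "\<bar>x\<bar>"] y_deriv(2)[of "\<bar>x\<bar>"] y'0
    by (cases x "0::real" rule: linorder_cases) (auto simp: deriv_u[of x] p_flux_minus p_flux_def[of _ 0])
qed

text \<open>Admissibility bounds a nonnegative integral over the half-line. Restricting it to
  \<open>{0..R}\<close> only decreases it, and continuity of the envelope turns the restriction into
  a gauge integral.\<close>

lemma integral_envelope_le:
  assumes "R \<ge> 0" shows "integral {0..R} envelope \<le> min \<xi>1 \<xi>2 powr (q - 1)"
proof -
  have h0: "0 \<le> envelope t" if "t \<ge> 0" for t
    using k_bounds[OF that] by simp
  have "continuous_on {0..R} envelope"
    using envelope_continuous by (rule continuous_on_subset) auto
  then have "(envelope has_integral integral {0..R} envelope) {0..R}"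
    by (intro integrable_integral integrable_continuous_real)
  then have "ennreal (integral {0..R} envelope) = (\<integral>\<^sup>+t\<in>{0..R}. ennreal (envelope t) \<partial>lborel)"
    using h0 by (intro nn_integral_has_integral_lebesgue'[symmetric]) auto
  also have "\<dots> \<le> (\<integral>\<^sup>+t\<in>{0..}. ennreal (envelope t) \<partial>lborel)"
    by (intro nn_integral_mono) (auto simp: indicator_def)
  also have "\<dots> \<le> ennreal (min \<xi>1 \<xi>2 powr (q - 1))"
    using adm unfolding admissible_1d_def by blast
  finally show ?thesis
    by (subst (asm) ennreal_le_iff) auto
qed

text \<open>Mass that the envelope carries beyond \<open>r\<close> is not available to the flux on \<open>[0, r]\<close>.\<close>

lemma G_le:
  assumes "0 \<le> t" "t \<le> r" "\<eta> \<ge> 0" "1 \<le> a" "a \<le> \<xi>1 * (1 + l)" "0 \<le> s" "s \<le> \<xi>2"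
    and low: "\<And>x. x \<in> {r..r+\<eta>} \<Longrightarrow> \<kappa> \<le> F (x, a, s)"
  shows "0 \<le> G t" "G t \<le> min \<xi>1 \<xi>2 powr (q - 1) - \<kappa> * \<eta>"
proof -
  have int: "k integrable_on {a..b}" "envelope integrable_on {a..b}" if "a \<ge> 0" for a b
    using that k_continuous envelope_continuous
    by (auto intro!: integrable_continuous_real elim: continuous_on_subset)
  show "0 \<le> G t"
    unfolding G_fun_def using k_bounds int by (intro integral_nonneg) auto
  have "G t \<le> integral {0..t} envelope"
    unfolding G_fun_def using k_bounds int by (intro integral_le) auto
  also have "\<dots> \<le> integral {0..r} envelope"
    using assms k_bounds int by (intro integral_subset_le) (force intro: order_trans)+
  finally have 1: "G t \<le> integral {0..r} envelope" .
  have "integral {r..r+\<eta>} (\<lambda>_. \<kappa>) \<le> integral {r..r+\<eta>} envelope"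
  proof (intro integral_le)
    fix x assume x: "x \<in> {r..r+\<eta>}"
    \<comment> \<open>The fixed pair \<open>(a, s)\<close> lies below
      \<open>(upper l \<xi>1 x, \<xi>2)\<close> for every \<open>x\<close> in the interval.\<close>
    have "F (x, a, s) \<le> envelope x"
      using x assms upper_ge[of x] by (intro F_mono) auto
    then show "\<kappa> \<le> envelope x" using low[OF x] by simp
  qed (use int assms in auto)
  then have 2: "\<kappa> * \<eta> \<le> integral {r..r+\<eta>} envelope"
    using assms by (simp add: mult.commute)
  have "integral {0..r} envelope + integral {r..r+\<eta>} envelope = integral {0..r+\<eta>} envelope"
    using assms int by (intro Henstock_Kurzweil_Integration.integral_combine) auto
  then show "G t \<le> min \<xi>1 \<xi>2 powr (q - 1) - \<kappa> * \<eta>"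
    using 1 2 integral_envelope_le[of "r+\<eta>"] assms by simp
qed

lemma G_deriv:
  assumes "t \<in> {0..r}"
  shows "(G has_real_derivative k t) (at t within {0..r})"
  unfolding G_fun_def using assms k_continuous
  by (intro integral_has_real_derivative) (auto elim: continuous_on_subset)

text \<open>Inverts \<open>G t = y' t powr (q - 1)\<close>. For \<delta> below 1 the exponent
  \<open>1 / (q - 1)\<close> makes the bound exponentially small as \<open>q\<close> decreases to
  1.\<close>

lemma y'_le:
  assumes "t \<ge> 0" "G t \<le> \<delta>"
  shows "y' t \<le> \<delta> powr (1 / (q - 1))"
proof -
  have "y' t = (G t) powr (1 / (q - 1))"
    using assms q y_bounds(3)[of t] by (simp add: flux_eq powr_powr)
  also have "\<dots> \<le> \<delta> powr (1 / (q - 1))"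
    using assms q by (intro powr_mono2) (auto simp: flux_eq)
  finally show ?thesis .
qed

lemma y_minus_1_le:
  assumes "0 \<le> t" "t \<le> r" "\<And>s. s \<in> {0..r} \<Longrightarrow> y' s \<le> d"
  shows "\<bar>y t - 1\<bar> \<le> r * d"
proof -
  \<comment> \<open>The mean value estimate is applied to \<open>u\<close>, which has two-sided
    derivatives at 0 as well.\<close>
  have "d * 0 - u 0 \<le> d * t - u t"
  proof (rule DERIV_nonneg_imp_nondecreasing[where f="\<lambda>x. d * x - u x"])
    fix x assume "0 \<le> x" "x \<le> t"
    then have "((\<lambda>x. d * x - u x) has_real_derivative d - deriv u x) (at x)" "deriv u x \<le> d"
      using assms(2) assms(3)[of x] y_deriv(2)[of x] u_deriv[of x] by (auto intro!: derivative_eq_intros)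
    then show "\<exists>D. ((\<lambda>x. d * x - u x) has_real_derivative D) (at x) \<and> D \<ge> 0"
      by fastforce
  qed (use assms in simp)
  then have "y t - 1 \<le> d * t"
    using assms by (simp add: u_eq y0)
  \<comment> \<open>Here \<open>d\<close> is nonnegative because it bounds
    \<open>y' 0 = 0\<close>.\<close>
  also have "\<dots> \<le> r * d"
    using assms assms(3)[of 0] y'0 by (simp add: mult.commute mult_left_mono)
  finally show ?thesis
    using y_bounds(1)[OF assms(1)] by simp
qed

end

section \<open>Stability of uniform limits\<close>

lemma uniform_limit_bound:
  fixes f :: "nat \<Rightarrow> 'a \<Rightarrow> 'b::metric_space"
  assumes "\<forall>\<^sub>F j in sequentially. \<forall>x\<in>S. dist (f j x) (g x) \<le> e j" and "e \<longlonglongrightarrow> 0"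
  shows "uniform_limit S f g sequentially"
proof (rule uniform_limitI)
  fix \<epsilon> :: real assume "\<epsilon> > 0"
  then have "\<forall>\<^sub>F j in sequentially. e j < \<epsilon>"
    using assms(2) by (simp add: order_tendsto_iff)
  with assms(1) show "\<forall>\<^sub>F j in sequentially. \<forall>x\<in>S. dist (f j x) (g x) < \<epsilon>"
    by eventually_elim force
qed

lemma uniform_limit_indefinite_integral:
  fixes f :: "nat \<Rightarrow> real \<Rightarrow> real"
  assumes "uniform_limit {a..b} f g sequentially" and "\<And>j. continuous_on {a..b} (f j)"
  shows "uniform_limit {a..b} (\<lambda>j t. integral {a..t} (f j)) (\<lambda>t. integral {a..t} g) sequentially"
proof (cases "a \<le> b")
  case True
  have contg: "continuous_on {a..b} g"
    using assms by (intro uniform_limit_theorem[where f=f and F=sequentially]) auto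
  show ?thesis
  proof (rule uniform_limitI)
    fix e :: real assume e: "e > 0"
    \<comment> \<open>The summand 1 keeps the denominator positive when \<open>a = b\<close> and
      makes the final inequality strict.\<close>
    define e' where "e' = e / (b - a + 1)"
    have e': "e' > 0" "e' * (b - a) < e"
      using e True by (auto simp: e'_def field_simps)
    have "\<forall>\<^sub>F j in sequentially. \<forall>x\<in>{a..b}. dist (f j x) (g x) < e'"
      using assms(1) e'(1) by (rule uniform_limitD)
    then show "\<forall>\<^sub>F j in sequentially. \<forall>t\<in>{a..b}. dist (integral {a..t} (f j)) (integral {a..t} g) < e"
    proof (rule eventually_mono, intro ballI)
      fix j t assume j: "\<forall>x\<in>{a..b}. dist (f j x) (g x) < e'" and t: "t \<in> {a..b}"
      have cont: "continuous_on {a..t} (f j)" "continuous_on {a..t} g"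
        using assms(2)[of j] contg t by (auto elim: continuous_on_subset)
      have "dist (integral {a..t} (f j)) (integral {a..t} g) = norm (integral {a..t} (\<lambda>x. f j x - g x))"
        using cont by (simp add: dist_norm Henstock_Kurzweil_Integration.integral_diff integrable_continuous_real)
      also have "\<dots> \<le> e' * (t - a)"
        using cont j t by (intro integral_bound continuous_intros) (force simp: dist_norm)+
      also have "\<dots> \<le> e' * (b - a)"
        using e' t by (intro mult_left_mono) auto
      also have "\<dots> < e" by (rule e')
      finally show "dist (integral {a..t} (f j)) (integral {a..t} g) < e" .
    qed
  qed
qed simp

lemma uniform_limit_even_extension:
  fixes r :: real
  assumes "uniform_limit {0..r} f g F"
  shows "uniform_limit {- r..r} (\<lambda>j x. f j \<bar>x\<bar>) (\<lambda>x. g \<bar>x\<bar>) F"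
  using assms by (rule uniform_limit_compose') auto

text \<open>Multiplication by \<open>sgn x\<close> preserves the distance away from 0 and sends both
  values to 0 at 0.\<close>

lemma uniform_limit_odd_extension:
  fixes f :: "'a \<Rightarrow> real \<Rightarrow> real"
  assumes "uniform_limit {0..r} f g F"
  shows "uniform_limit {- r..r} (\<lambda>j x. sgn x * f j \<bar>x\<bar>) (\<lambda>x. sgn x * g \<bar>x\<bar>) F"
proof (rule uniform_limitI)
  fix e :: real assume "e > 0"
  then have "\<forall>\<^sub>F j in F. \<forall>x\<in>{0..r}. dist (f j x) (g x) < e"
    using assms by (simp add: uniform_limitD)
  then show "\<forall>\<^sub>F j in F. \<forall>x\<in>{- r..r}. dist (sgn x * f j \<bar>x\<bar>) (sgn x * g \<bar>x\<bar>) < e"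
  proof (rule eventually_mono, intro ballI)
    fix j x assume j: "\<forall>x\<in>{0..r}. dist (f j x) (g x) < e" and "x \<in> {- r..r}"
    then have "\<bar>f j \<bar>x\<bar> - g \<bar>x\<bar>\<bar> < e" by (auto simp: dist_real_def)
    then show "dist (sgn x * f j \<bar>x\<bar>) (sgn x * g \<bar>x\<bar>) < e"
      using \<open>e > 0\<close> by (cases "x = 0") (auto simp: dist_real_def abs_mult abs_sgn_eq simp flip: right_diff_distrib)
  qed
qed

text \<open>The odd extension of a primitive of \<open>g\<close> is, up to a constant, the primitive
  from \<open>- r\<close> of the continuous even extension \<open>f\<close>. The fundamental theorem
  then covers 0 and both end points at once.\<close>

lemma odd_primitive_has_derivative:
  fixes g :: "real \<Rightarrow> real"
  assumes g: "continuous_on {0..r} g" and x: "x \<in> {- r..r}"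
  shows "((\<lambda>x. sgn x * integral {0..\<bar>x\<bar>} g) has_real_derivative g \<bar>x\<bar>) (at x within {- r..r})"
proof -
  define f where "f = (\<lambda>x. g \<bar>x\<bar>)"
  have f: "continuous_on {- r..r} f"
    unfolding f_def by (rule continuous_on_compose2[OF g]) (auto intro!: continuous_intros)
  have int: "f integrable_on {a..b}" if "- r \<le> a" "b \<le> r" for a b
    using that by (intro integrable_continuous_real continuous_on_subset[OF f]) auto
  have eq: "sgn x * integral {0..\<bar>x\<bar>} g = integral {- r..x} f - integral {- r..0} f"
    if "x \<in> {- r..r}" for x
  proof -
    have gf: "integral {0..\<bar>x\<bar>} g = integral {0..\<bar>x\<bar>} f"
      by (rule integral_cong) (simp add: f_def)
    show ?thesis
    proof (cases "x \<ge> 0")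
      case True
      then have "integral {- r..0} f + integral {0..x} f = integral {- r..x} f"
        using that int by (intro Henstock_Kurzweil_Integration.integral_combine) auto
      then show ?thesis using True gf by (cases "x = 0") auto
    next
      case False
      then have "integral {- r..x} f + integral {x..0} f = integral {- r..0} f"
        using that int by (intro Henstock_Kurzweil_Integration.integral_combine) auto
      moreover have "integral {x..0} f = integral {0..- x} f"
        using Henstock_Kurzweil_Integration.integral_reflect_real[of "- x" 0 f] by (simp add: f_def)
      ultimately show ?thesis using False gf by simp
    qed
  qed
  have "((\<lambda>x. integral {- r..x} f - integral {- r..0} f) has_real_derivative f x) (at x within {- r..r})"
    using integral_has_real_derivative[OF f x] by (auto intro!: derivative_eq_intros)
  then have "((\<lambda>x. sgn x * integral {0..\<bar>x\<bar>} g) has_real_derivative f x) (at x within {- r..r})"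
    by (rule has_field_derivative_transform_within[OF _ zero_less_one x]) (simp add: eq)
  then show ?thesis by (simp add: f_def)
qed

text \<open>The error splits into \<open>\<Phi> j - \<Psi>\<close> at the moving point, small
  uniformly on \<open>K\<close>, and the increment of \<Psi>, small because \<Psi> is uniformly
  continuous on \<open>K\<close>.\<close>

lemma uniform_limit_compose_continuous_compact:
  fixes \<Phi> :: "nat \<Rightarrow> 'b::metric_space \<Rightarrow> real"
  assumes "uniform_limit K \<Phi> \<Psi> sequentially" and "compact K" and "continuous_on K \<Psi>"
    and "uniform_limit S w w' sequentially" and "\<And>j x. x \<in> S \<Longrightarrow> w j x \<in> K"
  shows "uniform_limit S (\<lambda>j x. \<Phi> j (w j x)) (\<lambda>x. \<Psi> (w' x)) sequentially"
proof -
  have "uniform_limit S (\<lambda>j x. \<Phi> j (w j x) - \<Psi> (w j x)) (\<lambda>_. 0) sequentially"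
  proof (rule uniform_limitI)
    fix e :: real assume "e > 0"
    from uniform_limitD[OF assms(1) this]
    show "\<forall>\<^sub>F j in sequentially. \<forall>x\<in>S. dist (\<Phi> j (w j x) - \<Psi> (w j x)) 0 < e"
      by eventually_elim (use assms(5) in \<open>simp add: dist_real_def\<close>)
  qed
  moreover have "uniform_limit S (\<lambda>j x. \<Psi> (w j x)) (\<lambda>x. \<Psi> (w' x)) sequentially"
    using assms(4)
  proof (rule uniform_limit_compose_uniformly_continuous_on)
    show "uniformly_continuous_on K \<Psi>" "closed K"
      using assms(2,3) by (auto intro: compact_uniformly_continuous compact_imp_closed)
    show "\<forall>\<^sub>F j in sequentially. \<forall>x\<in>S. w j x \<in> K"
      using assms(5) by simp
  qed
  ultimately have "uniform_limit S (\<lambda>j x. (\<Phi> j (w j x) - \<Psi> (w j x)) + \<Psi> (w j x)) (\<lambda>x. 0 + \<Psi> (w' x)) sequentially"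
    by (rule uniform_limit_add)
  then show ?thesis by simp
qed

text \<open>The exponent tends to infinity from the right of 1 while the base stays below 1.\<close>

lemma powr_inverse_tendsto_0:
  assumes "0 < \<delta>" "\<delta> < (1::real)"
  shows "((\<lambda>q. \<delta> powr (1 / (q - 1))) \<longlongrightarrow> 0) (at_right 1)"
  using assms by real_asymp

section \<open>The limit of the exponents to 1\<close>

theorem theorem6p2:
  fixes l \<xi>1 \<xi>2 c r0 t0 \<rho>0 :: real
    and \<beta> :: "real \<Rightarrow> real"
    and F :: "real \<Rightarrow> real \<times> real \<times> real \<Rightarrow> real"
    and F1 :: "real \<times> real \<times> real \<Rightarrow> real"
    and p :: "nat \<Rightarrow> real"
    and u y :: "real \<Rightarrow> real \<Rightarrow> real"
  assumes "l \<ge> 0" and "\<xi>1 \<ge> 1" and "\<xi>2 > 0"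
    and "\<And>q. q \<in> {1<..<2} \<Longrightarrow> 0 \<le> \<beta> q \<and> \<beta> q \<le> q - 1"
    and "\<And>q. q \<in> {1<..<2} \<Longrightarrow> admissible_1d l \<xi>1 \<xi>2 q (F q)"
    and "\<exists>\<theta>\<in>{0<..1}. holder_loc \<theta> octant F1"
    and "\<And>K. compact K \<Longrightarrow> K \<subseteq> octant \<Longrightarrow> uniform_limit K F F1 (at_right 1)"
    and "((\<lambda>q. \<beta> q / (q - 1)) \<longlongrightarrow> c) (at_right 1)" and "c \<in> {0..1}"
    and "r0 > 0" and "t0 \<in> {1..\<xi>1 * (1 + l)}" and "\<rho>0 \<in> {0..\<xi>2}"
    and "F1 (r0, t0, \<rho>0) > 0"
    and "\<And>j. p j \<in> {1<..<2}" and "p \<longlonglongrightarrow> 1"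
    and "\<And>j. even_solution l \<xi>1 \<xi>2 (p j) (\<beta> (p j)) (F (p j)) (u (p j)) (y (p j))"
  shows
    "(\<exists>\<delta>\<in>{0<..<1}. \<exists>j0. \<forall>j\<ge>j0.
        Linf_norm {0<..<r0} (deriv_within {0..} (y (p j))) \<le> ereal (\<delta> powr (1 / (p j - 1))) \<and>
        Linf_norm {0<..<r0} (\<lambda>t. y (p j) t - 1) \<le> ereal (r0 * \<delta> powr (1 / (p j - 1)))) \<and>
     converges_C1 {- r0..r0} (\<lambda>j. u (p j)) (\<lambda>_. 1) \<and>
     converges_C0 {- r0..r0} (\<lambda>j x. u (p j) x powr (p j - 1)) (\<lambda>_. 1) \<and>
     converges_C0 {- r0..r0} (\<lambda>j x. u (p j) x powr (- \<beta> (p j))) (\<lambda>_. 1) \<and>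
     converges_C0 {0..r0} (\<lambda>j. k_fun (\<beta> (p j)) (F (p j)) (y (p j))) (\<lambda>t. F1 (t, 1, 0)) \<and>
     (\<forall>j. \<forall>t\<ge>0. G_fun (\<beta> (p j)) (F (p j)) (y (p j)) t
                  = deriv_within {0..} (y (p j)) t powr (p j - 1)) \<and>
     converges_C1 {0..r0} (\<lambda>j. G_fun (\<beta> (p j)) (F (p j)) (y (p j))) (G_lim F1) \<and>
     (\<forall>t\<in>{0..r0}. 0 \<le> G_lim F1 t \<and> G_lim F1 t < 1) \<and>
     (\<forall>j x. p_flux (p j) (deriv (u (p j)) x)
             = sgn x * G_fun (\<beta> (p j)) (F (p j)) (y (p j)) \<bar>x\<bar>) \<and>
     (\<forall>j. p_flux (p j) (deriv (u (p j)) 0) = 0) \<and>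
     converges_C1 {- r0..r0} (\<lambda>j x. p_flux (p j) (deriv (u (p j)) x))
       (\<lambda>x. sgn x * G_lim F1 \<bar>x\<bar>) \<and>
     (\<forall>x\<in>{- r0..r0}.
        ((\<lambda>x. sgn x * G_lim F1 \<bar>x\<bar>) has_real_derivative F1 (\<bar>x\<bar>, 1, 0)) (at x within {- r0..r0}) \<and>
        \<bar>sgn x * G_lim F1 \<bar>x\<bar>\<bar> < 1) \<and>
     one_laplace_eq {- r0<..<r0} (\<lambda>_. 1) (\<lambda>x. F1 (\<bar>x\<bar>, 1, \<bar>deriv (\<lambda>_. 1) x\<bar>)) \<and>
     (\<forall>x\<in>{- r0<..<r0}. F1 (\<bar>x\<bar>, 1, \<bar>deriv (\<lambda>_. 1) x\<bar>) = F1 (\<bar>x\<bar>, 1, 0))"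
proof -
  interpret S: solution_1d l \<xi>1 \<xi>2 "p j" "\<beta> (p j)" "F (p j)" "u (p j)" "y (p j)" for j
    using assms by unfold_locales auto
  let ?y' = "\<lambda>j. deriv_within {0..} (y (p j))"
  let ?k = "\<lambda>j. k_fun (\<beta> (p j)) (F (p j)) (y (p j))"
  let ?G = "\<lambda>j. G_fun (\<beta> (p j)) (F (p j)) (y (p j))"
  have r0: "r0 > 0" by (rule assms)
  have p: "p j \<in> {1<..<2}" for j by (rule assms)
  \<comment> \<open>All \<open>p j\<close> exceed 1, so limits along \<open>at_right 1\<close> can
    be pulled back to the sequence.\<close>
  have p_lim: "filterlim p (at_right 1) sequentially"
    using assms(15) p by (simp add: filterlim_at less_imp_neq[THEN not_sym])
  have F_lim: "uniform_limit K (\<lambda>j. F (p j)) F1 sequentially" if "compact K" "K \<subseteq> octant" for K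
    using filterlim_compose[OF assms(7)[OF that] p_lim] .
  have F1_cont: "continuous_on octant F1"
    using assms(6) by (auto intro: holder_loc_continuous_on)
  have F1_section: "continuous_on {0..} (\<lambda>t. F1 (t, a, s))" if "0 \<le> a" "0 \<le> s" for a s
    using that by (intro continuous_on_compose2[OF F1_cont] continuous_intros) (auto simp: octant_def)
  \<comment> \<open>Singletons are compact, so locally uniform convergence includes pointwise
    convergence.\<close>
  have F1_nonneg: "0 \<le> F1 w" if "w \<in> octant" for w
  proof -
    have "(\<lambda>j. F (p j) w) \<longlonglongrightarrow> F1 w"
      using F_lim[of "{w}"] that by simp
    then show ?thesis
      by (rule tendsto_lowerbound) (use S.F_nonneg[OF that] in auto)
  qed

  obtain \<delta> j0 where \<delta>: "0 < \<delta>" "\<delta> < 1"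
    and G_le: "\<And>j t. j \<ge> j0 \<Longrightarrow> t \<in> {0..r0} \<Longrightarrow> ?G j t \<le> \<delta>"
  proof -
    \<comment> \<open>A third of the positive value: continuity of \<open>F1\<close> near
      \<open>r0\<close> costs one \<kappa>, uniform convergence another, and \<open>F (p j)\<close>
      keeps at least \<kappa>.\<close>
    define \<kappa> where "\<kappa> = F1 (r0, t0, \<rho>0) / 3"
    have \<kappa>: "\<kappa> > 0" "F1 (r0, t0, \<rho>0) = 3 * \<kappa>" using assms(13) by (auto simp: \<kappa>_def)
    have t0: "0 \<le> t0" and \<rho>0: "0 \<le> \<rho>0" using assms by auto
    obtain d where d: "d > 0"
      "\<And>x. x \<in> {0..} \<Longrightarrow> dist x r0 < d \<Longrightarrow> dist (F1 (x, t0, \<rho>0)) (F1 (r0, t0, \<rho>0)) < \<kappa>"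
      using F1_section[OF t0 \<rho>0] r0 \<kappa>(1) unfolding continuous_on_iff by (metis atLeast_iff less_imp_le)
    \<comment> \<open>Half the radius, so that the closed interval \<open>{r0..r0+\<eta>}\<close>
      stays inside the open ball.\<close>
    define \<eta> where "\<eta> = d / 2"
    have \<eta>: "\<eta> > 0" using d by (simp add: \<eta>_def)
    have F1_low: "2 * \<kappa> < F1 (x, t0, \<rho>0)" if "x \<in> {r0..r0+\<eta>}" for x
      using d(2)[of x] d(1) that r0 \<kappa> by (auto simp: \<eta>_def dist_real_def)
    let ?K = "{r0..r0+\<eta>} \<times> {t0} \<times> {\<rho>0}"
    have "uniform_limit ?K (\<lambda>j. F (p j)) F1 sequentially"
      using r0 t0 \<rho>0 by (intro F_lim compact_Times) (auto simp: octant_def)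
    then have ev1: "\<forall>\<^sub>F j in sequentially. \<forall>w\<in>?K. dist (F (p j) w) (F1 w) < \<kappa>"
      using \<kappa>(1) by (rule uniform_limitD)
    have "(\<lambda>j. min \<xi>1 \<xi>2 powr (p j - 1)) \<longlonglongrightarrow> min \<xi>1 \<xi>2 powr (1 - 1)"
      using assms(2,3,15) by (intro tendsto_intros) auto
    then have "(\<lambda>j. min \<xi>1 \<xi>2 powr (p j - 1)) \<longlonglongrightarrow> 1"
      using assms(2,3) by (simp add: min_def split: if_splits)
    \<comment> \<open>The excess over 1 is half of the mass \<open>\<kappa> * \<eta>\<close> that is
      subtracted, which leaves \<open>1 - \<kappa> * \<eta> / 2\<close>.\<close>
    then have ev2: "\<forall>\<^sub>F j in sequentially. min \<xi>1 \<xi>2 powr (p j - 1) < 1 + \<kappa> * \<eta> / 2"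
      using \<kappa> \<eta> by (intro order_tendstoD) auto
    from ev1 ev2 have "\<forall>\<^sub>F j in sequentially. \<forall>t\<in>{0..r0}. ?G j t \<le> 1 - \<kappa> * \<eta> / 2"
    proof eventually_elim
      case (elim j)
      have low: "\<kappa> \<le> F (p j) (x, t0, \<rho>0)" if "x \<in> {r0..r0+\<eta>}" for x
      proof -
        have "dist (F (p j) (x, t0, \<rho>0)) (F1 (x, t0, \<rho>0)) < \<kappa>"
          using elim(1) that by auto
        then show ?thesis using F1_low[OF that] by (auto simp: dist_real_def)
      qed
      have "?G j t \<le> min \<xi>1 \<xi>2 powr (p j - 1) - \<kappa> * \<eta>" if "t \<in> {0..r0}" for t
        using that assms \<eta> low by (intro S.G_le[of t r0 \<eta> t0 \<rho>0 \<kappa> j]) auto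
      then show ?case using elim(2) by fastforce
    qed
    then obtain j0 where j0: "\<And>j t. j \<ge> j0 \<Longrightarrow> t \<in> {0..r0} \<Longrightarrow> ?G j t \<le> 1 - \<kappa> * \<eta> / 2"
      unfolding eventually_sequentially by blast
    \<comment> \<open>The maximum with 1/2 secures positivity of \<delta>, since
      \<open>1 - \<kappa> * \<eta> / 2\<close> need not be positive.\<close>
    show thesis
    proof (rule that[of "max (1/2) (1 - \<kappa> * \<eta> / 2)" j0])
      show "max (1/2) (1 - \<kappa> * \<eta> / 2) < 1" using \<kappa> \<eta> by auto
    qed (use j0 in \<open>auto simp: le_max_iff_disj\<close>)
  qed

  define d where "d = (\<lambda>j. \<delta> powr (1 / (p j - 1)))"
  have d_lim: "d \<longlonglongrightarrow> 0"
    unfolding d_def using filterlim_compose[OF powr_inverse_tendsto_0[OF \<delta>] p_lim] .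
  have y'_bound: "\<bar>?y' j t\<bar> \<le> d j" and y_bound: "\<bar>y (p j) t - 1\<bar> \<le> r0 * d j"
    if "j \<ge> j0" "t \<in> {0..r0}" for j t
  proof -
    have y'_le: "?y' j s \<le> d j" if "s \<in> {0..r0}" for s
      unfolding d_def using that \<open>j \<ge> j0\<close> by (intro S.y'_le G_le) auto
    then show "\<bar>?y' j t\<bar> \<le> d j" using S.y_bounds(3)[of t j] that by simp
    show "\<bar>y (p j) t - 1\<bar> \<le> r0 * d j"
      using that y'_le by (intro S.y_minus_1_le) auto
  qed
  have y'_cont: "continuous_on {0..r0} (?y' j)" and y_cont: "continuous_on {0..r0} (y (p j))"
    and k_cont: "continuous_on {0..r0} (?k j)" for j
    by (rule continuous_on_subset[OF S.y'_continuous] continuous_on_subset[OF S.y_continuous]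
        continuous_on_subset[OF S.k_continuous]; simp)+
  have ev: "\<forall>\<^sub>F j in sequentially. j \<ge> j0" by (rule eventually_ge_at_top)
  have y'_lim: "uniform_limit {0..r0} ?y' (\<lambda>_. 0) sequentially"
    by (rule uniform_limit_bound[OF eventually_mono[OF ev] d_lim]) (use y'_bound in simp)
  have rd_lim: "(\<lambda>j. r0 * d j) \<longlonglongrightarrow> 0"
    using tendsto_mult_left[OF d_lim, of r0] by simp
  have y_lim: "uniform_limit {0..r0} (\<lambda>j. y (p j)) (\<lambda>_. 1) sequentially"
    by (rule uniform_limit_bound[OF eventually_mono[OF ev] rd_lim]) (use y_bound in \<open>simp add: dist_real_def\<close>)

  have decay: "\<exists>\<delta>\<in>{0<..<1}. \<exists>j0. \<forall>j\<ge>j0.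
        Linf_norm {0<..<r0} (?y' j) \<le> ereal (\<delta> powr (1 / (p j - 1))) \<and>
        Linf_norm {0<..<r0} (\<lambda>t. y (p j) t - 1) \<le> ereal (r0 * \<delta> powr (1 / (p j - 1)))"
  proof (intro bexI[of _ \<delta>] exI[of _ j0] allI impI conjI)
    fix j assume j: "j \<ge> j0"
    have cont: "continuous_on {0<..<r0} (?y' j)" "continuous_on {0<..<r0} (y (p j))"
      by (rule continuous_on_subset[OF y'_cont] continuous_on_subset[OF y_cont]; force)+
    show "Linf_norm {0<..<r0} (?y' j) \<le> ereal (\<delta> powr (1 / (p j - 1)))"
      using y'_bound[OF j] cont by (intro Linf_norm_le) (auto simp: d_def)
    show "Linf_norm {0<..<r0} (\<lambda>t. y (p j) t - 1) \<le> ereal (r0 * \<delta> powr (1 / (p j - 1)))"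
      using y_bound[OF j] cont by (intro Linf_norm_le continuous_intros) (auto simp: d_def)
  qed (use \<delta> in auto)

  have u_cont: "continuous_on {- r0..r0} (u (p j))" for j
    using S.u_deriv by (meson DERIV_continuous_on has_field_derivative_at_within)
  have u_ge: "1 \<le> u (p j) x" for j x
    using S.y_bounds(1)[of "\<bar>x\<bar>" j] by (simp add: S.u_eq)
  have u_lim: "uniform_limit {- r0..r0} (\<lambda>j. u (p j)) (\<lambda>_. 1) sequentially"
    using uniform_limit_even_extension[OF y_lim] by (simp flip: S.u_eq)
  have u_C1: "converges_C1 {- r0..r0} (\<lambda>j. u (p j)) (\<lambda>_. 1)"
  proof (rule converges_C1_Icc_I)
    show "(u (p j) has_real_derivative deriv (u (p j)) x) (at x within {- r0..r0})" for j x
      by (rule has_field_derivative_at_within[OF S.u_deriv])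
    show "uniform_limit {- r0..r0} (\<lambda>j. deriv (u (p j))) (\<lambda>_. 0) sequentially"
      using uniform_limit_odd_extension[OF y'_lim] by (simp flip: S.deriv_u)
  qed (use r0 u_lim S.u_deriv_continuous in auto)

  have u_bound: "\<bar>u (p j) x - 1\<bar> \<le> r0 * d j" if "j \<ge> j0" "x \<in> {- r0..r0}" for j x
    using y_bound[of j "\<bar>x\<bar>"] that by (auto simp: S.u_eq)
  \<comment> \<open>Both exponents have modulus at most 1 and \<open>u \<ge> 1\<close>, so the
    powers lie between \<open>1 / u\<close> and \<open>u\<close>.\<close>
  have u_powr: "\<bar>u (p j) x powr (p j - 1) - 1\<bar> \<le> \<bar>u (p j) x - 1\<bar>"
    and u_powr_\<beta>: "\<bar>u (p j) x powr (- \<beta> (p j)) - 1\<bar> \<le> \<bar>u (p j) x - 1\<bar>" for j x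
  proof -
    let ?u = "u (p j) x"
    note 1 = u_ge[of j x]
    have \<beta>: "0 \<le> \<beta> (p j)" "\<beta> (p j) \<le> 1" using S.\<beta>[of j] p[of j] by auto
    have "?u powr 0 \<le> ?u powr (p j - 1)" "?u powr (p j - 1) \<le> ?u powr 1"
      using 1 p[of j] by (intro powr_mono; simp)+
    then show "\<bar>?u powr (p j - 1) - 1\<bar> \<le> \<bar>?u - 1\<bar>" using 1 by simp
    have "?u powr (-1) \<le> ?u powr (- \<beta> (p j))" "?u powr (- \<beta> (p j)) \<le> ?u powr 0"
      using 1 \<beta> by (intro powr_mono; simp)+
    \<comment> \<open>This is \<open>(u - 1)\<^sup>2 \<ge> 0\<close> divided by \<open>u\<close>; it
      bounds \<open>1 - 1 / u\<close> by \<open>u - 1\<close>.\<close>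
    moreover have "2 - ?u \<le> ?u powr (-1)"
    proof -
      have "(2 - ?u) * ?u \<le> 1"
        using zero_le_square[of "?u - 1"] by (simp add: algebra_simps)
      then show ?thesis using 1 by (simp add: powr_minus_divide field_simps)
    qed
    ultimately show "\<bar>?u powr (- \<beta> (p j)) - 1\<bar> \<le> \<bar>?u - 1\<bar>" using 1 by simp
  qed
  have powr_lim: "uniform_limit {- r0..r0} (\<lambda>j x. u (p j) x powr (p j - 1)) (\<lambda>_. 1) sequentially"
    by (rule uniform_limit_bound[OF eventually_mono[OF ev] rd_lim])
       (use order_trans[OF u_powr u_bound] in \<open>simp add: dist_real_def\<close>)
  have powr_\<beta>_lim: "uniform_limit {- r0..r0} (\<lambda>j x. u (p j) x powr (- \<beta> (p j))) (\<lambda>_. 1) sequentially"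
    by (rule uniform_limit_bound[OF eventually_mono[OF ev] rd_lim])
       (use order_trans[OF u_powr_\<beta> u_bound] in \<open>simp add: dist_real_def\<close>)
  have u_pos: "u (p j) x \<noteq> 0" for j x using u_ge[of j x] by auto
  have powr_C0: "converges_C0 {- r0..r0} (\<lambda>j x. u (p j) x powr (p j - 1)) (\<lambda>_. 1)"
    unfolding converges_C0_def using powr_lim u_cont u_pos by (auto intro!: continuous_intros)
  have powr_\<beta>_C0: "converges_C0 {- r0..r0} (\<lambda>j x. u (p j) x powr (- \<beta> (p j))) (\<lambda>_. 1)"
    unfolding converges_C0_def using powr_\<beta>_lim u_cont u_pos by (auto intro!: continuous_intros)

  let ?f = "\<lambda>t. F1 (t, 1, 0)"
  have f_cont: "continuous_on {0..r0} ?f"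
    using F1_section[of 1 0] by (auto elim: continuous_on_subset)
  have k_lim: "uniform_limit {0..r0} ?k ?f sequentially"
  proof -
    \<comment> \<open>A box containing all triples \<open>(t, y t, y' t)\<close> with
      \<open>t \<le> r0\<close>, for every \<open>j\<close>, by the a priori bounds on the
      solutions.\<close>
    let ?K = "{0..r0} \<times> {1..\<xi>1 * (1 + max l r0)} \<times> {0..\<xi>2}"
    have K: "compact ?K" "?K \<subseteq> octant"
      by (auto intro!: compact_Times simp: octant_def)
    have upper_le: "upper l \<xi>1 t \<le> \<xi>1 * (1 + max l r0)" if "t \<le> r0" for t
      using that assms(2) unfolding upper_def phi_def by (intro mult_left_mono) auto
    have w_lim: "uniform_limit {0..r0} (\<lambda>j t. (t, y (p j) t, ?y' j t)) (\<lambda>t. (t, 1, 0)) sequentially"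
    proof (rule uniform_limit_bound[OF eventually_mono[OF ev]])
      show "(\<lambda>j. r0 * d j + d j) \<longlonglongrightarrow> 0" using tendsto_add[OF rd_lim d_lim] by simp
      fix j assume j: "j \<ge> j0"
      have "dist (t, y (p j) t, ?y' j t) (t, 1, 0) \<le> \<bar>y (p j) t - 1\<bar> + \<bar>?y' j t\<bar>" for t
        using sqrt_sum_squares_le_sum_abs[of "\<bar>y (p j) t - 1\<bar>" "\<bar>?y' j t\<bar>"]
        by (simp add: dist_Pair_Pair dist_real_def)
      then show "\<forall>t\<in>{0..r0}. dist (t, y (p j) t, ?y' j t) (t, 1, 0) \<le> r0 * d j + d j"
        using y_bound[OF j] y'_bound[OF j] by (meson add_mono order_trans)
    qed
    have "uniform_limit {0..r0} (\<lambda>j t. F (p j) (t, y (p j) t, ?y' j t)) ?f sequentially"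
    proof (rule uniform_limit_compose_continuous_compact[OF F_lim[OF K] K(1) _ w_lim])
      show "continuous_on ?K F1" using F1_cont K(2) by (rule continuous_on_subset)
      fix j t assume "t \<in> {0..r0}"
      then show "(t, y (p j) t, ?y' j t) \<in> ?K"
        using S.y_bounds[of t j] upper_le[of t] by auto
    qed
    moreover have "uniform_limit {0..r0} (\<lambda>j t. y (p j) t powr (- \<beta> (p j))) (\<lambda>_. 1) sequentially"
    proof (rule uniform_limit_cong'[THEN iffD1])
      show "uniform_limit {0..r0} (\<lambda>j x. u (p j) x powr (- \<beta> (p j))) (\<lambda>_. 1) sequentially"
        using powr_\<beta>_lim by (rule uniform_limit_on_subset) auto
    qed (auto simp: S.u_eq)
    \<comment> \<open>A product of uniform limits converges uniformly when the limit factors are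
      bounded.\<close>
    moreover have "bounded (?f ` {0..r0})"
      using f_cont by (intro compact_imp_bounded compact_continuous_image) auto
    ultimately have "uniform_limit {0..r0} (\<lambda>j t. F (p j) (t, y (p j) t, ?y' j t) * y (p j) t powr (- \<beta> (p j)))
        (\<lambda>t. ?f t * 1) sequentially"
      by (intro uniform_lim_mult) (auto simp: bounded_iff)
    then show ?thesis by (simp add: k_fun_def[abs_def])
  qed

  have G_lim: "uniform_limit {0..r0} ?G (G_lim F1) sequentially"
    unfolding G_fun_def[abs_def] G_lim_def[abs_def]
    by (rule uniform_limit_indefinite_integral[OF k_lim k_cont])
  have G_C1: "converges_C1 {0..r0} ?G (G_lim F1)"
  proof (rule converges_C1_Icc_I[OF r0 S.G_deriv _ k_cont G_lim k_lim])
    show "(G_lim F1 has_real_derivative ?f t) (at t within {0..r0})" if "t \<in> {0..r0}" for t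
      unfolding G_lim_def[abs_def] using f_cont that by (rule integral_has_real_derivative)
  qed
  have G_lim_bounds: "0 \<le> G_lim F1 t" "G_lim F1 t < 1" if "t \<in> {0..r0}" for t
  proof -
    have "(\<lambda>j. ?G j t) \<longlonglongrightarrow> G_lim F1 t"
      using G_lim that by (rule tendsto_uniform_limitI)
    \<comment> \<open>The bound \<delta> is independent of \<open>j\<close>, so the strict
      inequality with 1 survives the limit.\<close>
    then have "G_lim F1 t \<le> \<delta>"
      by (rule tendsto_upperbound) (use G_le[OF _ that] in \<open>auto intro: eventually_mono[OF ev]\<close>)
    then show "G_lim F1 t < 1" using \<delta> by simp
    show "0 \<le> G_lim F1 t"
      unfolding G_lim_def using F1_nonneg that f_cont
      by (intro integral_nonneg integrable_continuous_real) (auto simp: octant_def elim: continuous_on_subset)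
  qed

  let ?z = "\<lambda>x. sgn x * G_lim F1 \<bar>x\<bar>"
  have z_deriv: "(?z has_real_derivative F1 (\<bar>x\<bar>, 1, 0)) (at x within {- r0..r0})" if "x \<in> {- r0..r0}" for x
    unfolding G_lim_def using odd_primitive_has_derivative[OF f_cont that] .
  have z_bound: "\<bar>?z x\<bar> < 1" if "x \<in> {- r0..r0}" for x
    using G_lim_bounds[of "\<bar>x\<bar>"] that by (cases "x = 0") (auto simp: abs_mult abs_sgn_eq)
  have z_C1: "converges_C1 {- r0..r0} (\<lambda>j x. p_flux (p j) (deriv (u (p j)) x)) ?z"
  proof (rule converges_C1_Icc_I[OF _ has_field_derivative_at_within[OF S.flux_deriv] z_deriv])
    show "continuous_on {- r0..r0} (\<lambda>x. ?k j \<bar>x\<bar>)" for j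
      by (rule continuous_on_compose2[OF k_cont]) (auto intro!: continuous_intros)
    show "uniform_limit {- r0..r0} (\<lambda>j x. p_flux (p j) (deriv (u (p j)) x)) ?z sequentially"
      using uniform_limit_odd_extension[OF G_lim] by (simp add: S.flux_eq(2))
    show "uniform_limit {- r0..r0} (\<lambda>j x. ?k j \<bar>x\<bar>) (\<lambda>x. ?f \<bar>x\<bar>) sequentially"
      by (rule uniform_limit_even_extension[OF k_lim])
  qed (use r0 in auto)

  \<comment> \<open>The limit flux serves as the vector field \<open>z\<close> for the constant
    1.\<close>
  have laplace: "one_laplace_eq {- r0<..<r0} (\<lambda>_. 1) (\<lambda>x. ?f \<bar>x\<bar>)"
  proof (rule one_laplace_eq_const)
    fix x assume x: "x \<in> {- r0<..<r0}"
    then show "(?z has_real_derivative ?f \<bar>x\<bar>) (at x)"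
      using z_deriv[of x] by (simp add: at_within_Icc_at)
    show "\<bar>?z x\<bar> \<le> 1" using z_bound[of x] x by simp
  next
    show "continuous_on {- r0<..<r0} (\<lambda>x. ?f \<bar>x\<bar>)"
      by (rule continuous_on_compose2[OF f_cont]) (auto intro!: continuous_intros)
  qed

  have k_C0: "converges_C0 {0..r0} ?k ?f"
    unfolding converges_C0_def using k_cont f_cont k_lim by blast
  \<comment> \<open>The derivative of a constant is 0, which identifies the two forms of the
    right-hand side.\<close>
  show ?thesis
    using decay u_C1 powr_C0 powr_\<beta>_C0 k_C0 S.flux_eq G_C1 G_lim_bounds z_C1 z_deriv z_bound laplace
    by simp
qed

end
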